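(* Let $A\in\mathbb{R}^{m\times d}$, $b\in\mathbb{R}^m$ and $v\in\mathbb{R}^d$. Let $x\in\mathbb{R}^{d}$ be a random vector such that $\mathbb{E}(xx^{T}) = I_{d}$. Then $$\mathbb{E}\big(\langle Av-b, Ax\rangle\, x\big) = A^{T}(Av-b),$$ i.e. $\langle Av-b,Ax\rangle x$ is an unbiased estimator for the gradient of $v\mapsto\tfrac12\|Av-b\|^{2}$ at $v$.
   Context: $\|\cdot\|$ is the Euclidean norm, $\langle\cdot,\cdot\rangle$ the Euclidean inner product, $I_d$ the $d\times d$ identity matrix, and $v$ is deterministic. *)

theory Defs
  imports "HOL-Probability.Probability"
begin

text \<open>The matrix \<open>x x\<^sup>T\<close>, with \<open>x\<close> read as a \<open>d \<times> 1\<close> column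
  (the one-element index type \<open>1\<close> has to be given explicitly).\<close>

definition outer_self :: "real^'d::finite \<Rightarrow> real^'d^'d" where
  "outer_self x = (columnvector x :: real^1^'d) ** (rowvector x :: real^'d^1)"

text \<open>A Bochner integral of a non-integrable function is \<open>0\<close> by convention. Since
  \<open>mat 1 \<noteq> 0\<close>, a hypothesis that the expectation of \<open>outer_self \<circ> X\<close> is \<open>mat 1\<close>
  therefore includes the existence of that expectation.\<close>

end

theory Submission
  imports Defs
begin

text \<open>With \<open>r = A v - b\<close>, the estimator is a matrix-vector product in which the random part
  has been isolated: \<open>\<langle>r, A x\<rangle> x = \<langle>x, A\<^sup>T r\<rangle> x = (x x\<^sup>T) (A\<^sup>T r)\<close>. For a fixed vector \<open>w\<close>, the
  map \<open>Q \<mapsto> Q w\<close> is linear on a finite-dimensional space of matrices, hence continuous, and so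
  commutes with the Bochner integral. The expectation of the estimator is therefore
  \<open>E(x x\<^sup>T) (A\<^sup>T r) = A\<^sup>T r\<close>. Differentiating \<open>\<langle>r, r\<rangle> / 2\<close> in \<open>v\<close> shows that \<open>A\<^sup>T r\<close> is also the gradient of
  the least-squares objective.\<close>

lemma outer_self_mult_vector: "outer_self x *v w = (x \<bullet> w) *\<^sub>R x"
  by (simp add: vec_eq_iff outer_self_def matrix_matrix_mult_def matrix_vector_mult_def
      columnvector_def rowvector_def inner_vec_def sum_distrib_left mult_ac)

lemma bounded_linear_matrix_vector_mult_left:
  "bounded_linear (\<lambda>Q :: real^'n::finite^'m::finite. Q *v w)"
  by (intro linear_conv_bounded_linear[THEN iffD1] linearI)
    (simp_all add: matrix_vector_mult_add_rdistrib scaleR_matrix_vector_assoc)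

lemma inner_matrix_vector_mult_transpose:
  fixes A :: "real^'d::finite^'m::finite"
  shows "r \<bullet> (A *v x) = x \<bullet> (transpose A *v r)"
  by (metis dot_lmul_matrix inner_commute transpose_matrix_vector)

text \<open>The randomness enters the right-hand side only through a linear function of \<open>x x\<^sup>T\<close>,
  so the second moment of \<open>x\<close> determines the expectation of the estimator.\<close>

lemma stochastic_gradient_eq_outer_self:
  fixes A :: "real^'d::finite^'m::finite"
  shows "(r \<bullet> (A *v x)) *\<^sub>R x = outer_self x *v (transpose A *v r)"
  by (simp only: outer_self_mult_vector inner_matrix_vector_mult_transpose[of r A x])

text \<open>The differential at \<open>v\<close> in direction \<open>h\<close> is \<open>\<langle>A v - b, A h\<rangle>\<close>; moving \<open>A\<close> to the other
  side of the inner product exhibits the gradient.\<close>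

lemma GDERIV_half_norm_residual_squared:
  fixes A :: "real^'d::finite^'m::finite"
  shows "GDERIV (\<lambda>u. 1 / 2 * (norm (A *v u - b))\<^sup>2) v :> transpose A *v (A *v v - b)"
proof -
  have "((\<lambda>u. A *v u - b) has_derivative (\<lambda>h. A *v h)) (at v)"
    by (auto intro!: derivative_eq_intros bounded_linear_imp_has_derivative)
  from has_derivative_mult_right[OF has_derivative_inner[OF this this], of "1 / 2"]
  have "((\<lambda>u. 1 / 2 * ((A *v u - b) \<bullet> (A *v u - b))) has_derivative
      (\<lambda>h. (A *v v - b) \<bullet> (A *v h))) (at v)"
    by (simp add: inner_commute)
  then show ?thesis
    by (simp only: gderiv_def power2_norm_eq_inner
        inner_matrix_vector_mult_transpose[where A = A and r = "A *v v - b"])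
qed

theorem lemma1p1:
  fixes A :: "real^'d::finite^'m::finite" and b :: "real^'m" and v :: "real^'d"
    and M :: "'a measure" and X :: "'a \<Rightarrow> real^'d"
  assumes "prob_space M"
    and "X \<in> borel_measurable M"
    and "prob_space.expectation M (\<lambda>\<omega>. outer_self (X \<omega>)) = mat 1"
  shows "integrable M (\<lambda>\<omega>. ((A *v v - b) \<bullet> (A *v X \<omega>)) *\<^sub>R X \<omega>)
    \<and> prob_space.expectation M (\<lambda>\<omega>. ((A *v v - b) \<bullet> (A *v X \<omega>)) *\<^sub>R X \<omega>)
        = transpose A *v (A *v v - b)
    \<and> (GDERIV (\<lambda>u. 1 / 2 * (norm (A *v u - b))\<^sup>2) v :>
         prob_space.expectation M (\<lambda>\<omega>. ((A *v v - b) \<bullet> (A *v X \<omega>)) *\<^sub>R X \<omega>))"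
proof -
  let ?w = "transpose A *v (A *v v - b)"
  have "(mat 1 :: real^'d^'d) \<noteq> 0"
    by (simp add: vec_eq_iff mat_def)
  \<comment> \<open>The integral of a non-integrable function is \<open>0\<close>, so the nonzero second moment
    yields integrability.\<close>
  then have int: "integrable M (\<lambda>\<omega>. outer_self (X \<omega>))"
    using assms(3) not_integrable_integral_eq by metis
  note apply_w = bounded_linear_matrix_vector_mult_left[where w = ?w]
  have "integrable M (\<lambda>\<omega>. outer_self (X \<omega>) *v ?w)"
    using integrable_bounded_linear[OF apply_w int] .
  moreover have "(\<integral>\<omega>. outer_self (X \<omega>) *v ?w \<partial>M) = ?w"
    using integral_bounded_linear[OF apply_w int] assms(3) by simp
  ultimately show ?thesis
    by (simp only: stochastic_gradient_eq_outer_self GDERIV_half_norm_residual_squared)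
qed

end
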